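(* Let $n\ge5$. If $n$ is an odd integer, then the distance matrix $D(H_n)$ of the helm graph $H_n$ is singular.
   Context: Helm graph: for $n\ge4$, the wheel $W_n$ consists of a cycle on $v_1,\dots,v_{n-1}$ together with a vertex $v_0$ adjacent to all $v_i$; the helm graph $H_n$ (on $2n-1$ vertices) is obtained from $W_n$ by attaching to each $v_i$, $1\le i\le n-1$, a pendant vertex $u_i$. The distance matrix $D(H_n)$ has as entries the shortest-path distances, with vertices ordered $v_0,v_1,\dots,v_{n-1},u_1,\dots,u_{n-1}$. Explicitly, $$D(H_n)=\begin{bmatrix}0&\mathbf{e}'&2\mathbf{e}'\\ \mathbf{e}&2J_{n-1}-S&3J_{n-1}-S\\ 2\mathbf{e}&3J_{n-1}-S&4J_{n-1}-S-2I_{n-1}\end{bmatrix},$$ where a prime denotes transpose, $\mathbf{e}\in\mathbb{R}^{n-1}$ is the all-ones vector, $J_{n-1}$ the all-ones matrix, $I_{n-1}$ the identity, and $S$ is the circulant matrix of order $n-1$ with first row $(2,1,0,\dots,0,1)$ (each row is the previous one cyclically shifted one place to the right). *)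

theory Defs
  imports "Graph_Theory.Pair_Digraph" "Graph_Theory.Shortest_Path" "Jordan_Normal_Form.Matrix"
begin

text \<open>Undirected graphs are symmetric loop-free digraphs without parallel arcs
  (\<^locale>\<open>pair_graph\<close>): each edge is a pair of opposite arcs.\<close>

text \<open>The distance is the number of arcs of a shortest walk.  It is real-valued, so pairs of
  vertices that are not joined by a walk get the junk value \<open>0\<close>; helm graphs are connected.\<close>

definition graph_dist :: "'a pair_pre_digraph \<Rightarrow> 'a \<Rightarrow> 'a \<Rightarrow> real" where
  "graph_dist G u v = real_of_ereal (wf_digraph.\<mu> (with_proj G) (\<lambda>_. 1) u v)"

definition distance_matrix :: "'a pair_pre_digraph \<Rightarrow> 'a list \<Rightarrow> real mat" where
  "distance_matrix G vs =
     mat (length vs) (length vs) (\<lambda>(i, j). graph_dist G (vs ! i) (vs ! j))"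

text \<open>\<open>Wheel i\<close> is \<open>v\<^sub>i\<close> (with hub \<open>v\<^sub>0\<close>) and \<open>Pendant i\<close> is \<open>u\<^sub>i\<close>.\<close>

datatype helm_vertex = Wheel nat | Pendant nat

text \<open>The index \<open>n\<close> counts the vertices of the wheel, hub included, so that the rim is a cycle
  on \<open>n - 1\<close> vertices.  On the rim, \<open>i mod (n - 1) + 1\<close> is the cyclic successor of \<open>i\<close>.
  These are the usual graphs for \<open>n \<ge> 4\<close>.\<close>

definition wheel_graph :: "nat \<Rightarrow> helm_vertex pair_pre_digraph" where
  "wheel_graph n =
     \<lparr> pverts = Wheel ` {0..n - 1},
       parcs = symcl ({(Wheel 0, Wheel i) | i. i \<in> {1..n - 1}} \<union>
                      {(Wheel i, Wheel (i mod (n - 1) + 1)) | i. i \<in> {1..n - 1}}) \<rparr>"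

definition helm_graph :: "nat \<Rightarrow> helm_vertex pair_pre_digraph" where
  "helm_graph n =
     \<lparr> pverts = pverts (wheel_graph n) \<union> Pendant ` {1..n - 1},
       parcs = parcs (wheel_graph n) \<union>
               symcl {(Wheel i, Pendant i) | i. i \<in> {1..n - 1}} \<rparr>"

definition helm_vertices :: "nat \<Rightarrow> helm_vertex list" where
  "helm_vertices n = map Wheel [0..<n] @ map Pendant [1..<n]"

definition helm_distance_matrix :: "nat \<Rightarrow> real mat" where
  "helm_distance_matrix n = distance_matrix (helm_graph n) (helm_vertices n)"

lemma set_helm_vertices: "n \<ge> 4 \<Longrightarrow> set (helm_vertices n) = pverts (helm_graph n)"
  by (auto simp: helm_vertices_def helm_graph_def wheel_graph_def)

lemma length_helm_vertices: "n \<ge> 4 \<Longrightarrow> length (helm_vertices n) = 2 * n - 1"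
  by (simp add: helm_vertices_def)

lemma distinct_helm_vertices: "distinct (helm_vertices n)"
  by (auto simp: helm_vertices_def distinct_map inj_on_def)

text \<open>Needed to unfold \<^const>\<open>wf_digraph.\<mu>\<close>, whose defining equation presupposes a
  well-formed digraph.\<close>

lemma pair_graph_helm_graph:
  assumes "n \<ge> 4"
  shows "pair_graph (helm_graph n)"
proof -
  have succ_le: "Suc (i mod (n - Suc 0)) \<le> n - Suc 0" for i
    using assms by (simp add: Suc_le_eq)
  have succ_neq: "Suc (i mod (n - Suc 0)) \<noteq> i" if "i \<le> n - Suc 0" for i
    using assms that by (cases "i = n - Suc 0") auto
  have arcs_sub: "parcs (helm_graph n) \<subseteq> pverts (helm_graph n) \<times> pverts (helm_graph n)"
    using succ_le by (auto simp: helm_graph_def wheel_graph_def symcl_def)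
  have fin: "finite (pverts (helm_graph n))"
    by (simp add: helm_graph_def wheel_graph_def)
  have fin_arcs: "finite (parcs (helm_graph n))"
    by (rule finite_subset[OF arcs_sub]) (simp add: fin)
  have loopfree: "fst e \<noteq> snd e" if "e \<in> parcs (helm_graph n)" for e
    using that succ_neq by (auto simp: helm_graph_def wheel_graph_def symcl_def dest: sym)
  have sym: "sym (parcs (helm_graph n))"
    by (auto simp: helm_graph_def wheel_graph_def symcl_def sym_def)
  show ?thesis
    by unfold_locales (use arcs_sub fin fin_arcs loopfree sym in \<open>auto simp: symmetric_def\<close>)
qed

end

theory Submission
  imports Defs
begin

text \<open>The vector supported on the rim \<open>v\<^sub>1, \<dots>, v\<^sub>n\<^sub>-\<^sub>1\<close> with alternating entries
  \<open>(-1)\<^sup>i\<close>, which closes up consistently because \<open>n - 1\<close> is even, lies in the kernel.  Indeed the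
  hub and a pendant vertex \<open>u\<^sub>j\<close> see the rim at distance \<open>1\<close> and \<open>1 + d(v\<^sub>j, v\<^sub>i)\<close>, and the
  constants cancel; the distances \<open>d(v\<^sub>j, v\<^sub>i)\<close> are \<open>2\<close> up to a correction of \<open>-2\<close> at \<open>j\<close> and
  \<open>-1\<close> at its two neighbours, which the alternating signs annihilate.\<close>

text \<open>A potential that drops by at most one along each arc bounds the length of every walk to
  \<open>t\<close> from below, and following descent arcs gives a walk attaining the bound.
  Distances are thus certified by a guessed function.\<close>

lemma (in wf_digraph) \<mu>_eqI:
  fixes h :: "'a \<Rightarrow> nat"
  assumes u: "u \<in> verts G"
    and target: "h t = 0"
    and arc: "\<And>e. e \<in> arcs G \<Longrightarrow> h (tail G e) \<le> Suc (h (head G e))"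
    and descent: "\<And>x. x \<in> verts G \<Longrightarrow> x \<noteq> t \<Longrightarrow>
      \<exists>e \<in> arcs G. tail G e = x \<and> h x = Suc (h (head G e))"
  shows "\<mu> (\<lambda>_. 1) u t = ereal (real (h u))"
proof -
  have lower: "real (h x) \<le> awalk_cost (\<lambda>_. 1) p" if "awalk x p t" for x p
    using that
  proof (induction p arbitrary: x)
    case Nil
    then show ?case by (simp add: awalk_Nil_iff target)
  next
    case (Cons e p)
    then have e: "e \<in> arcs G" "tail G e = x" and "awalk (head G e) p t"
      by (auto simp: awalk_Cons_iff)
    with Cons.IH have "real (h (head G e)) \<le> awalk_cost (\<lambda>_. 1) p" by blast
    moreover have "h x \<le> Suc (h (head G e))" using arc e by blast
    ultimately show ?case by simp
  qed
  have upper: "\<exists>p. awalk x p t \<and> awalk_cost (\<lambda>_. 1) p = real (h x)" if "x \<in> verts G" for x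
    using that
  \<comment> \<open>A descent arc lowers \<open>h\<close> by exactly one, so prepending it to the
    walk from its head keeps length and potential equal.\<close>
  proof (induction "h x" arbitrary: x rule: less_induct)
    case less
    show ?case
    proof (cases "x = t")
      case True
      then show ?thesis
        using less.prems target by (intro exI[of _ "[]"]) (auto simp: awalk_Nil_iff)
    next
      case False
      then obtain e where e: "e \<in> arcs G" "tail G e = x" "h x = Suc (h (head G e))"
        using descent less.prems by blast
      then obtain p where "awalk (head G e) p t"
          "awalk_cost (\<lambda>_. 1) p = real (h (head G e))"
        using less.hyps[of "head G e"] by auto
      with e show ?thesis
        by (intro exI[of _ "e # p"]) (auto simp: awalk_Cons_iff)
    qed
  qed
  obtain p where "awalk u p t" "awalk_cost (\<lambda>_. 1) p = real (h u)"
    using upper u by blast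
  then have "\<mu> (\<lambda>_. 1) u t \<le> real (h u)"
    using min_cost_le_walk_cost by metis
  moreover have "real (h u) \<le> \<mu> (\<lambda>_. 1) u t"
    unfolding \<mu>_def by (rule INF_greatest) (simp add: lower)
  ultimately show ?thesis by (rule antisym)
qed

definition rim_succ :: "nat \<Rightarrow> nat \<Rightarrow> nat" where
  "rim_succ n i = i mod (n - 1) + 1"

text \<open>The detour through the hub caps distances between rim vertices at 2.\<close>

definition rim_dist :: "nat \<Rightarrow> nat \<Rightarrow> nat \<Rightarrow> nat" where
  "rim_dist n i j =
     (if i = j then 0 else if j = rim_succ n i \<or> i = rim_succ n j then 1 else 2)"

text \<open>The target is always the rim vertex \<open>Wheel i\<close>, since the kernel vector
  meets only rim columns.\<close>

fun helm_dist :: "nat \<Rightarrow> nat \<Rightarrow> helm_vertex \<Rightarrow> nat" where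
  "helm_dist n i (Wheel j) = (if j = 0 then 1 else rim_dist n i j)"
| "helm_dist n i (Pendant j) = Suc (rim_dist n i j)"

lemma rim_succ_eq:
  assumes "j \<in> {1..n - 1}"
  shows "rim_succ n j = (if j = n - 1 then 1 else Suc j)"
  using assms by (auto simp: rim_succ_def)

lemma pverts_helm_graph:
  "pverts (helm_graph n) = Wheel ` {0..n - 1} \<union> Pendant ` {1..n - 1}"
  by (simp add: helm_graph_def wheel_graph_def)

lemma parcs_helm_graph:
  "parcs (helm_graph n) = (\<Union>i\<in>{1..n - 1}.
     {(Wheel 0, Wheel i), (Wheel i, Wheel 0),
      (Wheel i, Wheel (rim_succ n i)), (Wheel (rim_succ n i), Wheel i),
      (Wheel i, Pendant i), (Pendant i, Wheel i)})"
  unfolding helm_graph_def wheel_graph_def symcl_def rim_succ_def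
  by (auto simp: image_iff)

lemma graph_dist_helm_graph:
  assumes n: "n \<ge> 4" and i: "i \<in> {1..n - 1}" and u: "u \<in> pverts (helm_graph n)"
  shows "graph_dist (helm_graph n) u (Wheel i) = real (helm_dist n i u)"
proof -
  interpret pair_graph "helm_graph n" using n by (rule pair_graph_helm_graph)
  have "wf_digraph.\<mu> (with_proj (helm_graph n)) (\<lambda>_. 1) u (Wheel i) =
      ereal (real (helm_dist n i u))"
  proof (rule \<mu>_eqI)
    show "helm_dist n i (Wheel i) = 0" using i by (simp add: rim_dist_def)
    \<comment> \<open>Between wheel vertices the values lie in 0, 1, 2, so only an arc from value 2
      to the target could fail; neighbours of the target have value 1.\<close>
    show "helm_dist n i (fst e) \<le> Suc (helm_dist n i (snd e))" if "e \<in> parcs (helm_graph n)" for e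
      using that i by (auto simp: parcs_helm_graph rim_dist_def rim_succ_def)
    show "\<exists>e\<in>parcs (helm_graph n). fst e = x \<and> helm_dist n i x = Suc (helm_dist n i (snd e))"
      if x: "x \<in> pverts (helm_graph n)" "x \<noteq> Wheel i" for x
    proof -
      have "\<exists>y. (x, y) \<in> parcs (helm_graph n) \<and> helm_dist n i x = Suc (helm_dist n i y)"
      proof (cases x)
        case (Pendant j)
        with x have "j \<in> {1..n - 1}" by (auto simp: pverts_helm_graph)
        then show ?thesis using Pendant
          by (intro exI[of _ "Wheel j"]) (auto simp: parcs_helm_graph)
      next
        case (Wheel j)
        with x have j: "j \<le> n - 1" "j \<noteq> i" by (auto simp: pverts_helm_graph)
        show ?thesis
        \<comment> \<open>The hub and the rim neighbours of the target step straight onto it; rim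
          vertices at distance 2 step to the hub.\<close>
        proof (cases "j = 0 \<or> rim_dist n i j = 1")
          case True
          then have "j = 0 \<or> j = rim_succ n i \<or> i = rim_succ n j"
            by (simp add: rim_dist_def split: if_splits)
          moreover have "j = 0 \<or> j \<in> {1..n - 1}" using j by auto
          ultimately consider "j = 0" | "j = rim_succ n i" | "j \<in> {1..n - 1}" "i = rim_succ n j"
            by blast
          then have "(x, Wheel i) \<in> parcs (helm_graph n)"
            using Wheel i by cases (auto simp: parcs_helm_graph)
          then show ?thesis
            using Wheel True i by (intro exI[of _ "Wheel i"]) (auto simp: rim_dist_def)
        next
          case False
          then have "(x, Wheel 0) \<in> parcs (helm_graph n)"
            using Wheel j by (auto simp: parcs_helm_graph)
          then show ?thesis
            using Wheel False j
            by (intro exI[of _ "Wheel 0"]) (auto simp: rim_dist_def split: if_splits)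
        qed
      qed
      then show ?thesis by force
    qed
  qed (use u in simp)
  then show ?thesis by (simp add: graph_dist_def)
qed

lemma sum_alternating_eq_0:
  assumes "odd n"
  shows "(\<Sum>i = 1..n - 1. (-1) ^ i :: 'a::ring_1) = 0"
proof -
  have "(\<Sum>i = 1..2 * k. (-1) ^ i :: 'a) = 0" for k
    by (induction k) auto
  then show ?thesis using assms by (metis odd_two_times_div_two_nat)
qed

lemma sum_alternating_rim_dist:
  assumes n: "n \<ge> 4" "odd n" and j: "j \<in> {1..n - 1}"
  shows "(\<Sum>i = 1..n - 1. (-1) ^ i * real (rim_dist n i j)) = 0"
proof -
  \<comment> \<open>\<open>p\<close> is the cyclic predecessor of \<open>j\<close>, the other rim
    neighbour.\<close>
  define p where "p = (if j = 1 then n - 1 else j - 1)"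
  have p: "p \<in> {1..n - 1}" and s: "rim_succ n j \<in> {1..n - 1}"
    using n j by (auto simp: p_def rim_succ_eq)
  \<comment> \<open>The sign flips even across the closing edge from \<open>n - 1\<close> to 1,
    because \<open>n - 1\<close> is even.\<close>
  have sgn_s: "(-1) ^ rim_succ n j = - ((-1) ^ j :: real)"
    using n j by (simp add: rim_succ_eq)
  have sgn_p: "(-1) ^ p = - ((-1) ^ j :: real)"
    using n j by (cases j) (auto simp: p_def)
  \<comment> \<open>The corrections do not overlap: \<open>j\<close>, its successor and
    \<open>p\<close> are distinct, as the rim has at least three vertices.\<close>
  have dist: "real (rim_dist n i j) = 2 - 2 * of_bool (i = j) - of_bool (i = rim_succ n j) - of_bool (i = p)"
    if "i \<in> {1..n - 1}" for i
    using that n j by (auto simp: rim_dist_def rim_succ_eq p_def)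
  have pick: "(\<Sum>i = 1..n - 1. (-1) ^ i * of_bool (i = k)) = ((-1) ^ k :: real)"
    if "k \<in> {1..n - 1}" for k
    using that by (simp add: of_bool_def if_distrib[of "(*) _"] sum.delta cong: if_cong)
  have "(\<Sum>i = 1..n - 1. (-1) ^ i * real (rim_dist n i j)) =
      2 * (\<Sum>i = 1..n - 1. (-1) ^ i) - 2 * (\<Sum>i = 1..n - 1. (-1) ^ i * of_bool (i = j))
      - (\<Sum>i = 1..n - 1. (-1) ^ i * of_bool (i = rim_succ n j))
      - (\<Sum>i = 1..n - 1. (-1) ^ i * of_bool (i = p))"
    unfolding sum_distrib_left sum_subtractf[symmetric]
    by (rule sum.cong) (simp_all only: dist algebra_simps)
  also have "\<dots> = 0"
    unfolding pick[OF j] pick[OF s] pick[OF p] sum_alternating_eq_0[OF n(2)] sgn_s sgn_p by simp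
  finally show ?thesis .
qed

lemma sum_alternating_helm_dist:
  assumes n: "n \<ge> 4" "odd n" and u: "u \<in> pverts (helm_graph n)"
  shows "(\<Sum>i = 1..n - 1. (-1) ^ i * real (helm_dist n i u)) = 0"
proof (cases u)
  case (Wheel j)
  then have "j \<le> n - 1" using u by (auto simp: pverts_helm_graph)
  then show ?thesis
    using Wheel sum_alternating_eq_0[OF n(2)] sum_alternating_rim_dist[OF n]
    by (cases "j = 0") auto
next
  case (Pendant j)
  then have "j \<in> {1..n - 1}" using u by (auto simp: pverts_helm_graph)
  then show ?thesis
    using Pendant sum_alternating_eq_0[OF n(2)] sum_alternating_rim_dist[OF n]
    by (simp add: distrib_left sum.distrib)
qed

lemma not_invertible_mat_if_kernel:
  fixes A :: "'a::comm_ring_1 mat"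
  assumes A: "A \<in> carrier_mat k k" and v: "v \<in> carrier_vec k"
    and "v \<noteq> 0\<^sub>v k" "A *\<^sub>v v = 0\<^sub>v k"
  shows "\<not> invertible_mat A"
proof
  assume "invertible_mat A"
  then obtain B where "A * B = 1\<^sub>m k" and BA: "B * A = 1\<^sub>m (dim_row B)"
    using A unfolding invertible_mat_def inverts_mat_def by auto
  \<comment> \<open>Comparing column counts in the two product identities fixes both dimensions of
    \<open>B\<close>.\<close>
  then have B: "B \<in> carrier_mat k k"
    using A by (metis carrier_matD(2) carrier_matI index_mult_mat(3) index_one_mat(3))
  have "v = (B * A) *\<^sub>v v" using BA B v by simp
  also have "\<dots> = B *\<^sub>v 0\<^sub>v k"
    using A B v assms(4) by (simp add: assoc_mult_mat_vec[of _ k k _ k])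
  also have "\<dots> = 0\<^sub>v k" using B by auto
  finally show False using assms(3) by blast
qed

theorem theorem3p1:
  fixes n :: nat
  assumes "n \<ge> 5" and "odd n"
  shows "\<not> invertible_mat (helm_distance_matrix n)"
proof -
  have n: "n \<ge> 4" using assms by simp
  define N where "N = 2 * n - 1"
  \<comment> \<open>The hub occupies position 0 of \<open>helm_vertices n\<close>, so position
    \<open>i\<close> in this range is exactly \<open>Wheel i\<close>.\<close>
  define v :: "real vec" where "v = vec N (\<lambda>i. if i \<in> {1..n - 1} then (-1) ^ i else 0)"
  have len: "length (helm_vertices n) = N"
    using length_helm_vertices[OF n] by (simp add: N_def)
  have sub: "{1..n - 1} \<subseteq> {0..<N}" using n by (auto simp: N_def)
  have carrier: "helm_distance_matrix n \<in> carrier_mat N N"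
    by (simp add: helm_distance_matrix_def distance_matrix_def len)
  show ?thesis
  proof (rule not_invertible_mat_if_kernel[OF carrier])
    show "v \<in> carrier_vec N" by (simp add: v_def)
    have "v $ 1 = -1" and "1 < N" using n by (auto simp: v_def N_def)
    then show "v \<noteq> 0\<^sub>v N" by auto
    show "helm_distance_matrix n *\<^sub>v v = 0\<^sub>v N"
    proof (rule eq_vecI)
      fix r assume "r < dim_vec (0\<^sub>v N :: real vec)"
      then have r: "r < N" by simp
      define u where "u = helm_vertices n ! r"
      have u: "u \<in> pverts (helm_graph n)"
        using r len set_helm_vertices[OF n] nth_mem by (auto simp: u_def)
      have "(helm_distance_matrix n *\<^sub>v v) $ r =
          (\<Sum>i = 0..<N. graph_dist (helm_graph n) u (helm_vertices n ! i) * v $ i)"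
        using r by (simp add: helm_distance_matrix_def distance_matrix_def len scalar_prod_def
            u_def v_def)
      \<comment> \<open>Outside the rim positions \<open>v\<close> vanishes, leaving only columns
        whose distances are given by \<open>helm_dist\<close>.\<close>
      also have "\<dots> = (\<Sum>i = 1..n - 1. graph_dist (helm_graph n) u (helm_vertices n ! i) * v $ i)"
        using sub by (intro sum.mono_neutral_right) (auto simp: v_def)
      also have "\<dots> = (\<Sum>i = 1..n - 1. (-1) ^ i * real (helm_dist n i u))"
      proof (rule sum.cong)
        fix i assume i: "i \<in> {1..n - 1}"
        then have "helm_vertices n ! i = Wheel i"
          by (auto simp: helm_vertices_def nth_append)
        moreover have "v $ i = (-1) ^ i" using i sub by (auto simp: v_def)
        ultimately show "graph_dist (helm_graph n) u (helm_vertices n ! i) * v $ i =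
            (-1) ^ i * real (helm_dist n i u)"
          using graph_dist_helm_graph[OF n i u] by simp
      qed simp
      also have "\<dots> = 0" using sum_alternating_helm_dist[OF n assms(2) u] .
      finally show "(helm_distance_matrix n *\<^sub>v v) $ r = 0\<^sub>v N $ r" using r by simp
    qed (use carrier in simp)
  qed
qed

end
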